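(* Let $n\ge 2$ be an integer, let $k>0$, $a>0$, $b-a>0$, $\eta>0$ and $\zeta\ge 0$ be real numbers, and let $\phi\in(0,\infty)^n$. Then $$\frac{\beta_{\zeta,k}^{(a,b)}(\phi;\eta)}{\beta_k(\phi;\eta)}\ \ge\ {}_1F_{1,k}\!\left(a;b;-\frac{\zeta^k}{\eta^k n^n}\right).$$
   Context: $E_{n-1}=\{(t_1,\dots,t_{n-1})\in\mathbb{R}^{n-1}: t_i\ge 0,\ \sum_{i=1}^{n-1}t_i\le 1\}$; for $t\in E_{n-1}$ put $t_n=1-\sum_{i=1}^{n-1}t_i$, $\pi(t)=\prod_{i=1}^n t_i$, $dt=dt_1\cdots dt_{n-1}$. For $c>0$, $(c)_{0,k}=1$ and $(c)_{m,k}=c(c+k)\cdots(c+(m-1)k)$ for $m\ge1$. The confluent hypergeometric $k$-function is ${}_1F_{1,k}(a;b;x)=\sum_{m=0}^\infty \frac{(a)_{m,k}}{(b)_{m,k}}\frac{x^m}{m!}$, $x\in\mathbb{R}$. For $\phi\in(0,\infty)^n$, $$\beta_{\zeta,k}^{(a,b)}(\phi;\eta)=\frac1{k^{n-1}}\int_{E_{n-1}}\prod_{i=1}^n t_i^{\frac{\phi_i}{k}-1}\;{}_1F_{1,k}\!\left(a;b;-\frac{\eta^k}{k\pi(t)}-\zeta^k\frac{\pi(t)}{\eta^k}\right)dt,$$ $$\beta_k(\phi;\eta)=\frac1{k^{n-1}}\int_{E_{n-1}}\left(\prod_{i=1}^n t_i^{\frac{\phi_i}{k}-1}\right)e^{-\frac{\eta^k}{k\pi(t)}}\,dt.$$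 *)

theory Defs
  imports "HOL-Analysis.Analysis"
begin

text \<open>
  Points of \<open>\<real>\<^sup>n\<^sup>-\<^sup>1\<close> are extensional functions on the index set \<open>{1..<n}\<close>, and \<open>dt\<close> is the
  product \<open>PiM {1..<n} (\<lambda>_. lborel)\<close> of Lebesgue measures.  Only the values of \<open>\<phi>\<close> on
  \<open>{1..n}\<close> matter.
\<close>

definition k_pochhammer :: "real \<Rightarrow> real \<Rightarrow> nat \<Rightarrow> real" where
  "k_pochhammer k c m = (\<Prod>j<m. c + real j * k)"

definition hyp1F1_k :: "real \<Rightarrow> real \<Rightarrow> real \<Rightarrow> real \<Rightarrow> real" where
  "hyp1F1_k k a b x = (\<Sum>m. k_pochhammer k a m / k_pochhammer k b m * (x ^ m / fact m))"

definition simplex_E :: "nat \<Rightarrow> (nat \<Rightarrow> real) set" where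
  "simplex_E n =
     {t \<in> {1..<n} \<rightarrow>\<^sub>E UNIV. (\<forall>i\<in>{1..<n}. 0 \<le> t i) \<and> (\<Sum>i\<in>{1..<n}. t i) \<le> 1}"

text \<open>Appends the dependent coordinate \<open>t\<^sub>n = 1 - (t\<^sub>1 + \<dots> + t\<^sub>n\<^sub>-\<^sub>1)\<close>.\<close>

definition full_coords :: "nat \<Rightarrow> (nat \<Rightarrow> real) \<Rightarrow> nat \<Rightarrow> real" where
  "full_coords n t = t(n := 1 - (\<Sum>i\<in>{1..<n}. t i))"

definition coord_prod :: "nat \<Rightarrow> (nat \<Rightarrow> real) \<Rightarrow> real" where
  "coord_prod n t = (\<Prod>i\<in>{1..n}. full_coords n t i)"

text \<open>
  In the two integrands below, the conventions \<open>x / 0 = 0\<close> and \<open>0 powr y = 0\<close> only affect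
  points of \<open>simplex_E n\<close> with some vanishing coordinate \<open>t\<^sub>i\<close>, which form a null set.
\<close>

definition ext_beta_k ::
    "nat \<Rightarrow> real \<Rightarrow> real \<Rightarrow> real \<Rightarrow> real \<Rightarrow> (nat \<Rightarrow> real) \<Rightarrow> real \<Rightarrow> real" where
  "ext_beta_k n k \<zeta> a b \<phi> \<eta> =
     1 / k ^ (n - 1) *
     (LINT t:simplex_E n|PiM {1..<n} (\<lambda>_. lborel).
        (\<Prod>i\<in>{1..n}. full_coords n t i powr (\<phi> i / k - 1)) *
        hyp1F1_k k a b
          (- (\<eta> powr k / (k * coord_prod n t)) - \<zeta> powr k * (coord_prod n t / \<eta> powr k)))"

definition beta_k :: "nat \<Rightarrow> real \<Rightarrow> (nat \<Rightarrow> real) \<Rightarrow> real \<Rightarrow> real" where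
  "beta_k n k \<phi> \<eta> =
     1 / k ^ (n - 1) *
     (LINT t:simplex_E n|PiM {1..<n} (\<lambda>_. lborel).
        (\<Prod>i\<in>{1..n}. full_coords n t i powr (\<phi> i / k - 1)) *
        exp (- (\<eta> powr k / (k * coord_prod n t))))"

end

theory Submission
  imports Defs
begin

text \<open>
  With \<open>\<alpha> = a / k\<close> and \<open>\<gamma> = (b - a) / k\<close>, Euler's integral exhibits \<open>hyp1F1_k k a b x\<close> as
  the mean of \<open>exp (x * U)\<close> for \<open>U\<close> with the Beta distribution of parameters \<open>\<alpha>, \<gamma>\<close>.
  Since \<open>0 \<le> U \<le> 1\<close>, the value at \<open>- A - B\<close> is at least \<open>exp (- A)\<close> times the value at \<open>- B\<close>,
  which in turn decreases in \<open>B\<close>.  By AM-GM \<open>\<pi>(t) \<le> 1 / n ^ n\<close> on the simplex, so the asserted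
  inequality holds pointwise between the integrands.  The Dirichlet integral is finite and
  positive, which gives integrability and positivity of the denominator.
\<close>

section \<open>The Dirichlet integral\<close>

text \<open>The cutoff puts the domain of integration into the integrand, so that all integrals run
  over full lines or product spaces. At \<open>0\<close> it agrees with \<open>powr\<close>, since
  \<open>0 powr y = 0\<close>. The shift \<open>p - 1\<close> makes the parameters those of the Beta
  function, which add under convolution.\<close>

definition pos_powr :: "real \<Rightarrow> real \<Rightarrow> real" where
  "pos_powr p x = (if 0 < x then x powr (p - 1) else 0)"

lemma pos_powr_nonneg [simp]: "0 \<le> pos_powr p x"
  by (simp add: pos_powr_def)

lemma pos_powr_eq: "0 \<le> x \<Longrightarrow> pos_powr p x = x powr (p - 1)"
  by (auto simp: pos_powr_def)

lemma pos_powr_nonpos [simp]: "x \<le> 0 \<Longrightarrow> pos_powr p x = 0"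
  by (simp add: pos_powr_def)

lemma measurable_pos_powr [measurable]: "pos_powr p \<in> borel_measurable borel"
  unfolding pos_powr_def by measurable

lemma pos_powr_scale: "0 < r \<Longrightarrow> pos_powr p (r * x) = r powr (p - 1) * pos_powr p x"
  by (auto simp: pos_powr_def powr_mult zero_less_mult_iff)

lemma power_mult_pos_powr: "u ^ m * pos_powr p u = pos_powr (p + real m) u"
  by (auto simp: pos_powr_def powr_realpow[symmetric] powr_add[symmetric] algebra_simps)

lemma Beta_real_pos: "0 < p \<Longrightarrow> 0 < q \<Longrightarrow> 0 < Beta p (q :: real)"
  by (simp add: Beta_def Gamma_real_pos)

lemma nn_integral_pos_powr_Beta:
  assumes "0 < p" "0 < q"
  shows "(\<integral>\<^sup>+t. ennreal (pos_powr p t * pos_powr q (1 - t)) \<partial>lborel) = ennreal (Beta p q)"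
proof (rule nn_integral_has_integral_lborel)
  have "((\<lambda>t. if t \<in> {0..1} then t powr (p - 1) * (1 - t) powr (q - 1) else 0)
          has_integral Beta p q) UNIV"
    using has_integral_Beta_real[OF assms] by (simp only: has_integral_restrict_UNIV)
  also have "(\<lambda>t. if t \<in> {0..1} then t powr (p - 1) * (1 - t) powr (q - 1) else 0)
      = (\<lambda>t. pos_powr p t * pos_powr q (1 - t))"
    by (auto simp: fun_eq_iff pos_powr_def)
  finally show "((\<lambda>t. pos_powr p t * pos_powr q (1 - t)) has_integral Beta p q) UNIV" .
qed auto

text \<open>For \<open>r > 0\<close> the substitution \<open>t = r * u\<close> reduces to the Beta
  integral; the Jacobian \<open>r\<close> and the two extracted powers combine to
  \<open>r powr (p + q - 1)\<close>. For \<open>r \<le> 0\<close> the numbers \<open>t\<close> and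
  \<open>r - t\<close> are never both positive, so both sides vanish.\<close>

lemma nn_integral_pos_powr_convolution:
  assumes "0 < p" "0 < q"
  shows "(\<integral>\<^sup>+t. ennreal (pos_powr p t * pos_powr q (r - t)) \<partial>lborel)
           = ennreal (Beta p q * pos_powr (p + q) r)"
proof (cases "0 < r")
  case True
  have "(\<integral>\<^sup>+t. ennreal (pos_powr p t * pos_powr q (r - t)) \<partial>lborel)
      = ennreal r * (\<integral>\<^sup>+t. ennreal (pos_powr p (r * t) * pos_powr q (r - r * t)) \<partial>lborel)"
    using True by (subst nn_integral_real_affine[where c = r and t = 0]) auto
  also have "(\<lambda>t. pos_powr p (r * t) * pos_powr q (r - r * t))
      = (\<lambda>t. (r powr (p - 1) * r powr (q - 1)) * (pos_powr p t * pos_powr q (1 - t)))"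
  proof
    fix t
    have "r - r * t = r * (1 - t)"
      by (simp add: algebra_simps)
    then show "pos_powr p (r * t) * pos_powr q (r - r * t)
        = (r powr (p - 1) * r powr (q - 1)) * (pos_powr p t * pos_powr q (1 - t))"
      using True by (simp add: pos_powr_scale)
  qed
  also have "(\<integral>\<^sup>+t. ennreal ((r powr (p - 1) * r powr (q - 1))
        * (pos_powr p t * pos_powr q (1 - t))) \<partial>lborel)
      = ennreal (r powr (p - 1) * r powr (q - 1)) * ennreal (Beta p q)"
    using assms
    by (simp add: ennreal_mult' nn_integral_cmult nn_integral_pos_powr_Beta[symmetric])
  also have "ennreal r * (ennreal (r powr (p - 1) * r powr (q - 1)) * ennreal (Beta p q))
      = ennreal (r * (r powr (p - 1) * r powr (q - 1) * Beta p q))"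
    using True Beta_real_pos[OF assms] by (simp add: ennreal_mult' less_imp_le)
  also have "r * (r powr (p - 1) * r powr (q - 1) * Beta p q) = Beta p q * pos_powr (p + q) r"
  proof -
    have "r * (r powr (p - 1) * r powr (q - 1)) = r powr 1 * (r powr (p - 1) * r powr (q - 1))"
      using True by simp
    also have "\<dots> = r powr (p + q - 1)"
      by (simp only: powr_add[symmetric]) (simp add: algebra_simps)
    finally show ?thesis
      using True by (simp add: pos_powr_def mult_ac)
  qed
  finally show ?thesis .
next
  case False
  then have zero: "pos_powr p t * pos_powr q (r - t) = 0" for t
    by (auto simp: pos_powr_def)
  show ?thesis
    unfolding zero using False by simp
qed

text \<open>Induction on the index set, integrating the new coordinate out by the convolution
  formula. This changes both the last parameter and the total, hence \<open>q\<close> and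
  \<open>s\<close> are kept general. The constant stays existential because only its finiteness and
  positivity matter later.\<close>

lemma nn_integral_dirichlet:
  assumes "finite S" "\<And>i. i \<in> S \<Longrightarrow> 0 < p i" "0 < q"
  shows "\<exists>C>0. \<forall>s. (\<integral>\<^sup>+t. ennreal ((\<Prod>i\<in>S. pos_powr (p i) (t i)) * pos_powr q (s - (\<Sum>i\<in>S. t i)))
            \<partial>PiM S (\<lambda>_. lborel)) = ennreal (C * pos_powr (q + (\<Sum>i\<in>S. p i)) s)"
  using assms
proof (induction S arbitrary: q)
  case empty
  show ?case
    by (intro exI[of _ 1]) (simp add: PiM_empty nn_integral_count_space_finite)
next
  case (insert x S)
  interpret product_sigma_finite "\<lambda>_. lborel :: real measure" ..
  have px: "0 < p x"
    using insert.prems by simp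
  \<comment> \<open>Convolving in coordinate \<open>x\<close> replaces the last parameter
    \<open>q\<close> by \<open>p x + q\<close>, so the induction hypothesis is taken there.\<close>
  obtain C where C: "C > 0" and CI: "\<And>s. (\<integral>\<^sup>+t. ennreal ((\<Prod>i\<in>S. pos_powr (p i) (t i))
        * pos_powr (p x + q) (s - (\<Sum>i\<in>S. t i))) \<partial>PiM S (\<lambda>_. lborel))
      = ennreal (C * pos_powr (p x + q + (\<Sum>i\<in>S. p i)) s)"
    using insert.IH[of "p x + q"] insert.prems px by auto
  have B: "0 < Beta (p x) q"
    using Beta_real_pos px insert.prems by simp
  have "(\<integral>\<^sup>+t. ennreal ((\<Prod>i\<in>insert x S. pos_powr (p i) (t i))
          * pos_powr q (s - (\<Sum>i\<in>insert x S. t i))) \<partial>PiM (insert x S) (\<lambda>_. lborel))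
      = ennreal (Beta (p x) q * C * pos_powr (q + (\<Sum>i\<in>insert x S. p i)) s)" for s
  proof -
    let ?P = "\<lambda>t :: 'a \<Rightarrow> real. \<Prod>i\<in>S. pos_powr (p i) (t i)"
    have "(\<integral>\<^sup>+t. ennreal ((\<Prod>i\<in>insert x S. pos_powr (p i) (t i))
          * pos_powr q (s - (\<Sum>i\<in>insert x S. t i))) \<partial>PiM (insert x S) (\<lambda>_. lborel))
        = (\<integral>\<^sup>+t. (\<integral>\<^sup>+y. ennreal ((\<Prod>i\<in>insert x S. pos_powr (p i) ((t(x := y)) i))
          * pos_powr q (s - (\<Sum>i\<in>insert x S. (t(x := y)) i))) \<partial>lborel) \<partial>PiM S (\<lambda>_. lborel))"
      using insert.hyps by (subst product_nn_integral_insert) auto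
    also have "\<dots> = (\<integral>\<^sup>+t. (\<integral>\<^sup>+y. ennreal (?P t) * ennreal (pos_powr (p x) y
          * pos_powr q ((s - (\<Sum>i\<in>S. t i)) - y)) \<partial>lborel) \<partial>PiM S (\<lambda>_. lborel))"
    proof (intro nn_integral_cong)
      fix t :: "'a \<Rightarrow> real" and y :: real
      have "(\<Prod>i\<in>S. pos_powr (p i) ((t(x := y)) i)) = ?P t" "(\<Sum>i\<in>S. (t(x := y)) i) = (\<Sum>i\<in>S. t i)"
        using insert.hyps by (auto intro!: prod.cong sum.cong)
      then show "ennreal ((\<Prod>i\<in>insert x S. pos_powr (p i) ((t(x := y)) i))
          * pos_powr q (s - (\<Sum>i\<in>insert x S. (t(x := y)) i)))
          = ennreal (?P t) * ennreal (pos_powr (p x) y * pos_powr q ((s - (\<Sum>i\<in>S. t i)) - y))"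
        using insert.hyps
        by (simp add: ennreal_mult'[symmetric] prod_nonneg mult_ac diff_diff_eq add.commute)
    qed
    also have "\<dots> = (\<integral>\<^sup>+t. ennreal (Beta (p x) q) * ennreal (?P t
          * pos_powr (p x + q) (s - (\<Sum>i\<in>S. t i))) \<partial>PiM S (\<lambda>_. lborel))"
    proof (intro nn_integral_cong)
      fix t :: "'a \<Rightarrow> real"
      have "(\<integral>\<^sup>+y. ennreal (?P t) * ennreal (pos_powr (p x) y
            * pos_powr q ((s - (\<Sum>i\<in>S. t i)) - y)) \<partial>lborel)
          = ennreal (?P t) * ennreal (Beta (p x) q * pos_powr (p x + q) (s - (\<Sum>i\<in>S. t i)))"
        using px insert.prems
        by (subst nn_integral_cmult) (simp_all add: nn_integral_pos_powr_convolution)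
      also have "\<dots> = ennreal (Beta (p x) q) * ennreal (?P t
          * pos_powr (p x + q) (s - (\<Sum>i\<in>S. t i)))"
        using B by (simp add: ennreal_mult'[symmetric] prod_nonneg less_imp_le mult_ac)
      finally show "(\<integral>\<^sup>+y. ennreal (?P t) * ennreal (pos_powr (p x) y
            * pos_powr q ((s - (\<Sum>i\<in>S. t i)) - y)) \<partial>lborel)
          = ennreal (Beta (p x) q) * ennreal (?P t
          * pos_powr (p x + q) (s - (\<Sum>i\<in>S. t i)))" .
    qed
    also have "\<dots> = ennreal (Beta (p x) q)
        * ennreal (C * pos_powr (p x + q + (\<Sum>i\<in>S. p i)) s)"
      by (subst nn_integral_cmult) (auto simp: CI)
    also have "\<dots> = ennreal (Beta (p x) q * C * pos_powr (q + (\<Sum>i\<in>insert x S. p i)) s)"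
      using insert.hyps B C by (simp add: ennreal_mult'[symmetric] less_imp_le mult_ac add_ac)
    finally show ?thesis .
  qed
  then show ?case
    using B C by (intro exI[of _ "Beta (p x) q * C"]) auto
qed

section \<open>Euler's integral for the confluent hypergeometric k-function\<close>

text \<open>Reduces to classical Pochhammer symbols; in the coefficients of \<open>hyp1F1_k\<close>
  the factors \<open>k ^ m\<close> cancel.\<close>

lemma k_pochhammer_eq: "k \<noteq> 0 \<Longrightarrow> k_pochhammer k c m = k ^ m * pochhammer (c / k) m"
  unfolding k_pochhammer_def pochhammer_prod
  by (induction m) (auto simp: field_simps lessThan_Suc atLeast0LessThan)

text \<open>Divided by \<open>Beta \<alpha> \<gamma>\<close>, these are the moments of the Beta
  distribution. They follow by writing both Pochhammer symbols as quotients of Gamma values.\<close>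

lemma Beta_add_nat:
  assumes "0 < \<alpha>" "0 < (\<gamma> :: real)"
  shows "Beta (\<alpha> + real m) \<gamma> = pochhammer \<alpha> m / pochhammer (\<alpha> + \<gamma>) m * Beta \<alpha> \<gamma>"
proof -
  have nz: "\<alpha> \<notin> \<int>\<^sub>\<le>\<^sub>0" "\<alpha> + \<gamma> \<notin> \<int>\<^sub>\<le>\<^sub>0"
    using assms by (auto elim!: nonpos_Ints_cases)
  have "Gamma \<alpha> \<noteq> 0" "Gamma (\<alpha> + \<gamma>) \<noteq> 0"
    using assms by (simp_all add: Gamma_real_pos less_imp_neq[symmetric])
  then show ?thesis
    by (simp add: Beta_def pochhammer_Gamma[OF nz(1)] pochhammer_Gamma[OF nz(2)] add_ac)
qed

text \<open>The unnormalised Beta density, supported on the open unit interval.\<close>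

definition beta_weight :: "real \<Rightarrow> real \<Rightarrow> real \<Rightarrow> real" where
  "beta_weight \<alpha> \<gamma> u = pos_powr \<alpha> u * pos_powr \<gamma> (1 - u)"

lemma beta_weight_nonneg [simp]: "0 \<le> beta_weight \<alpha> \<gamma> u"
  by (simp add: beta_weight_def)

lemma measurable_beta_weight [measurable]: "beta_weight \<alpha> \<gamma> \<in> borel_measurable borel"
  unfolding beta_weight_def by measurable

lemma beta_weight_eq_0: "u \<le> 0 \<or> 1 \<le> u \<Longrightarrow> beta_weight \<alpha> \<gamma> u = 0"
  by (auto simp: beta_weight_def)

text \<open>The factor \<open>u ^ m\<close> only raises the first Beta parameter by
  \<open>m\<close>.\<close>

lemma has_bochner_integral_beta_weight:
  assumes "0 < \<alpha>" "0 < \<gamma>"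
  shows "has_bochner_integral lborel (\<lambda>u. beta_weight \<alpha> \<gamma> u * u ^ m)
           (pochhammer \<alpha> m / pochhammer (\<alpha> + \<gamma>) m * Beta \<alpha> \<gamma>)"
proof -
  have "has_bochner_integral lborel (beta_weight (\<alpha> + real m) \<gamma>) (Beta (\<alpha> + real m) \<gamma>)"
    using assms nn_integral_pos_powr_Beta[of "\<alpha> + real m" \<gamma>] Beta_real_pos[of "\<alpha> + real m" \<gamma>]
    by (intro has_bochner_integral_nn_integral) (auto simp: beta_weight_def[abs_def])
  moreover have "beta_weight (\<alpha> + real m) \<gamma> = (\<lambda>u. beta_weight \<alpha> \<gamma> u * u ^ m)"
    by (auto simp: fun_eq_iff beta_weight_def power_mult_pos_powr[symmetric])
  ultimately show ?thesis
    using assms by (simp add: Beta_add_nat)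
qed

text \<open>Expand \<open>exp (x * u)\<close> in powers of \<open>u\<close> and integrate term by
  term: the Beta moments produce exactly the coefficients of the series.\<close>

lemma hyp1F1_k_integral:
  assumes "0 < k" "0 < a" "0 < b - a"
  defines "\<alpha> \<equiv> a / k" and "\<gamma> \<equiv> (b - a) / k"
  shows "integrable lborel (\<lambda>u. beta_weight \<alpha> \<gamma> u * exp (x * u))"
    and "hyp1F1_k k a b x = (\<integral>u. beta_weight \<alpha> \<gamma> u * exp (x * u) \<partial>lborel) / Beta \<alpha> \<gamma>"
proof -
  have pos: "0 < \<alpha>" "0 < \<gamma>"
    using assms by (simp_all add: \<alpha>_def \<gamma>_def)
  have B: "0 < Beta \<alpha> \<gamma>"
    using pos by (rule Beta_real_pos)
  define f where "f m u = beta_weight \<alpha> \<gamma> u * u ^ m * (x ^ m / fact m)" for m u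
  have f_hbi: "has_bochner_integral lborel (f m)
      (pochhammer \<alpha> m / pochhammer (\<alpha> + \<gamma>) m * Beta \<alpha> \<gamma> * (x ^ m / fact m))" for m
    unfolding f_def
    by (intro has_bochner_integral_mult_left has_bochner_integral_beta_weight pos)
  have exp_sums: "(\<lambda>m. f m u) sums (beta_weight \<alpha> \<gamma> u * exp (x * u))" for u
  proof -
    have "(\<lambda>m. beta_weight \<alpha> \<gamma> u * ((x * u) ^ m /\<^sub>R fact m)) sums
        (beta_weight \<alpha> \<gamma> u * exp (x * u))"
      by (intro sums_mult exp_converges)
    moreover have "(\<lambda>m. beta_weight \<alpha> \<gamma> u * ((x * u) ^ m /\<^sub>R fact m)) = (\<lambda>m. f m u)"
      by (auto simp: f_def fun_eq_iff power_mult_distrib field_simps)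
    ultimately show ?thesis
      by simp
  qed
  have suminf_f: "(\<lambda>u. \<Sum>m. f m u) = (\<lambda>u. beta_weight \<alpha> \<gamma> u * exp (x * u))"
    using exp_sums by (auto simp: fun_eq_iff sums_iff)
  have norm_f: "norm (f m u) \<le> beta_weight \<alpha> \<gamma> u * (\<bar>x\<bar> ^ m / fact m)" for m u
  proof (cases "0 < u \<and> u < 1")
    case True
    then have "\<bar>u\<bar> ^ m \<le> 1"
      by (intro power_le_one) auto
    then have "beta_weight \<alpha> \<gamma> u * \<bar>u\<bar> ^ m * (\<bar>x\<bar> ^ m / fact m)
        \<le> beta_weight \<alpha> \<gamma> u * 1 * (\<bar>x\<bar> ^ m / fact m)"
      by (intro mult_right_mono mult_left_mono) auto
    then show ?thesis
      by (simp add: f_def abs_mult power_abs)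
  next
    case False
    then show ?thesis
      by (auto simp: f_def beta_weight_eq_0 not_less)
  qed
  have w: "has_bochner_integral lborel (beta_weight \<alpha> \<gamma>) (Beta \<alpha> \<gamma>)"
    using has_bochner_integral_beta_weight[OF pos, of 0] by simp
  have exp_summable: "summable (\<lambda>m. c * (\<bar>x\<bar> ^ m / fact m))" for c
    using summable_exp_generic[of "\<bar>x\<bar>"] by (intro summable_mult) (simp add: field_simps)
  have summ1: "AE u in lborel. summable (\<lambda>m. norm (f m u))"
    by (intro AE_I2 summable_comparison_test'[OF exp_summable]) (use norm_f in auto)
  have summ2: "summable (\<lambda>m. \<integral>u. norm (f m u) \<partial>lborel)"
  proof (rule summable_comparison_test'[OF exp_summable])
    fix m
    have "(\<integral>u. norm (f m u) \<partial>lborel) \<le> (\<integral>u. beta_weight \<alpha> \<gamma> u * (\<bar>x\<bar> ^ m / fact m) \<partial>lborel)"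
      using w f_hbi norm_f
      by (intro integral_mono integrable_norm integrable_mult_left)
        (auto simp: has_bochner_integral_iff)
    also have "\<dots> = Beta \<alpha> \<gamma> * (\<bar>x\<bar> ^ m / fact m)"
      using w by (simp add: has_bochner_integral_iff)
    finally show "norm (\<integral>u. norm (f m u) \<partial>lborel) \<le> Beta \<alpha> \<gamma> * (\<bar>x\<bar> ^ m / fact m)"
      by simp
  qed
  have f_int: "integrable lborel (f m)" for m
    using f_hbi by (simp add: has_bochner_integral_iff)
  show "integrable lborel (\<lambda>u. beta_weight \<alpha> \<gamma> u * exp (x * u))"
    using integrable_suminf[OF f_int summ1 summ2] by (simp add: suminf_f)
  have "(\<lambda>m. integral\<^sup>L lborel (f m)) sums (\<integral>u. beta_weight \<alpha> \<gamma> u * exp (x * u) \<partial>lborel)"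
    using sums_integral[OF f_int summ1 summ2] by (simp add: suminf_f)
  then have "(\<lambda>m. integral\<^sup>L lborel (f m) / Beta \<alpha> \<gamma>) sums
      ((\<integral>u. beta_weight \<alpha> \<gamma> u * exp (x * u) \<partial>lborel) / Beta \<alpha> \<gamma>)"
    by (rule sums_divide)
  moreover have "integral\<^sup>L lborel (f m) / Beta \<alpha> \<gamma>
      = k_pochhammer k a m / k_pochhammer k b m * (x ^ m / fact m)" for m
  proof -
    have "\<alpha> + \<gamma> = b / k"
      by (simp add: \<alpha>_def \<gamma>_def diff_divide_distrib)
    then show ?thesis
      using f_hbi[of m] B assms(1)
      by (simp add: has_bochner_integral_iff k_pochhammer_eq \<alpha>_def)
  qed
  ultimately show "hyp1F1_k k a b x
      = (\<integral>u. beta_weight \<alpha> \<gamma> u * exp (x * u) \<partial>lborel) / Beta \<alpha> \<gamma>"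
    unfolding hyp1F1_k_def by (simp add: sums_iff)
qed

section \<open>Order properties of the k-function\<close>

lemma hyp1F1_k_0 [simp]: "hyp1F1_k k a b 0 = 1"
  unfolding hyp1F1_k_def by (subst suminf_finite[of "{0}"]) (auto simp: k_pochhammer_def)

lemma measurable_hyp1F1_k [measurable]: "hyp1F1_k k a b \<in> borel_measurable borel"
  unfolding hyp1F1_k_def by measurable

text \<open>For negative \<open>x\<close> the series alternates in sign; the integral representation
  has a nonnegative integrand.\<close>

lemma hyp1F1_k_nonneg:
  assumes "0 < k" "0 < a" "0 < b - a"
  shows "0 \<le> hyp1F1_k k a b x"
  using assms Beta_real_pos[of "a / k" "(b - a) / k"]
  by (auto simp: hyp1F1_k_integral(2) intro!: divide_nonneg_nonneg Bochner_Integration.integral_nonneg)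

text \<open>The weight lives on \<open>u > 0\<close>, where \<open>exp (x * u)\<close> increases
  with \<open>x\<close>.\<close>

lemma hyp1F1_k_mono:
  assumes "0 < k" "0 < a" "0 < b - a" "x \<le> y"
  shows "hyp1F1_k k a b x \<le> hyp1F1_k k a b y"
proof -
  let ?w = "beta_weight (a / k) ((b - a) / k)"
  have "(\<integral>u. ?w u * exp (x * u) \<partial>lborel) \<le> (\<integral>u. ?w u * exp (y * u) \<partial>lborel)"
  proof (intro integral_mono hyp1F1_k_integral(1) assms)
    fix u :: real
    show "?w u * exp (x * u) \<le> ?w u * exp (y * u)"
      using assms(4) by (cases "0 < u") (auto simp: beta_weight_eq_0 intro!: mult_left_mono)
  qed
  then show ?thesis
    using assms Beta_real_pos[of "a / k" "(b - a) / k"]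
    by (auto simp: hyp1F1_k_integral(2) intro!: divide_right_mono)
qed

text \<open>On the support of the weight \<open>u < 1\<close>, hence
  \<open>exp (- A * u) \<ge> exp (- A)\<close>, and this factor leaves the integral.\<close>

lemma hyp1F1_k_ge_exp_mult:
  assumes "0 < k" "0 < a" "0 < b - a" "0 \<le> A"
  shows "exp (- A) * hyp1F1_k k a b x \<le> hyp1F1_k k a b (x - A)"
proof -
  let ?w = "beta_weight (a / k) ((b - a) / k)"
  have "exp (- A) * (\<integral>u. ?w u * exp (x * u) \<partial>lborel)
      = (\<integral>u. exp (- A) * (?w u * exp (x * u)) \<partial>lborel)"
    by simp
  also have "\<dots> \<le> (\<integral>u. ?w u * exp ((x - A) * u) \<partial>lborel)"
  proof (intro integral_mono integrable_mult_right hyp1F1_k_integral(1) assms)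
    fix u :: real
    show "exp (- A) * (?w u * exp (x * u)) \<le> ?w u * exp ((x - A) * u)"
    proof (cases "u < 1")
      case True
      then have "- A + x * u \<le> (x - A) * u"
        using mult_left_mono[of u 1 A] assms(4) by (simp add: algebra_simps)
      then have "?w u * exp (- A + x * u) \<le> ?w u * exp ((x - A) * u)"
        by (intro mult_left_mono) auto
      then show ?thesis
        by (simp only: exp_add mult_ac)
    qed (simp add: beta_weight_eq_0)
  qed
  finally have "exp (- A) * (\<integral>u. ?w u * exp (x * u) \<partial>lborel) / Beta (a / k) ((b - a) / k)
      \<le> (\<integral>u. ?w u * exp ((x - A) * u) \<partial>lborel) / Beta (a / k) ((b - a) / k)"
    using assms by (intro divide_right_mono less_imp_le[OF Beta_real_pos]) auto
  then show ?thesis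
    using assms by (simp add: hyp1F1_k_integral(2))
qed

section \<open>Integration over the simplex\<close>

declare One_nat_def [simp del]

lemma atLeastAtMost_eq_insert: "n \<ge> 1 \<Longrightarrow> {1..n} = insert n {1..<n}" for n :: nat
  by auto

lemma full_coords_last [simp]: "full_coords n t n = 1 - (\<Sum>i\<in>{1..<n}. t i)"
  by (simp add: full_coords_def)

lemma full_coords_less [simp]: "i \<in> {1..<n} \<Longrightarrow> full_coords n t i = t i"
  by (auto simp: full_coords_def)

lemma sum_full_coords: "n \<ge> 1 \<Longrightarrow> (\<Sum>i\<in>{1..n}. full_coords n t i) = 1"
  by (simp add: atLeastAtMost_eq_insert)

text \<open>The bound on the sum is nonnegativity of the appended coordinate; membership in the
  product space supplies extensionality.\<close>

lemma simplex_E_iff: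
  assumes "n \<ge> 1" "t \<in> space (PiM {1..<n} (\<lambda>_. lborel))"
  shows "t \<in> simplex_E n \<longleftrightarrow> (\<forall>i\<in>{1..n}. 0 \<le> full_coords n t i)"
  using assms by (auto simp: simplex_E_def space_PiM atLeastAtMost_eq_insert)

text \<open>AM-GM for the \<open>n\<close> full coordinates, whose sum is \<open>1\<close>, followed
  by taking \<open>n\<close>-th powers.\<close>

lemma coord_prod_le:
  assumes "n \<ge> 1" "\<And>i. i \<in> {1..n} \<Longrightarrow> 0 \<le> full_coords n t i"
  shows "coord_prod n t \<le> 1 / real n ^ n"
proof -
  have P: "0 \<le> coord_prod n t"
    unfolding coord_prod_def using assms by (intro prod_nonneg) auto
  have "coord_prod n t powr (1 / n) \<le> (\<Sum>i\<in>{1..n}. full_coords n t i / n)"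
    using arith_geom_mean[of "{1..n}" "full_coords n t"] assms by (simp add: coord_prod_def)
  also have "\<dots> = 1 / n"
    using assms by (simp add: sum_divide_distrib[symmetric] sum_full_coords)
  finally have "(coord_prod n t powr (1 / n)) ^ n \<le> (1 / n) ^ n"
    by (intro power_mono) auto
  moreover have "(coord_prod n t powr (1 / n)) ^ n = coord_prod n t"
    using P assms(1) by (cases "coord_prod n t = 0") (auto simp: powr_realpow[symmetric] powr_powr)
  ultimately show ?thesis
    by (simp add: power_divide)
qed

lemma measurable_full_coords [measurable]:
  assumes "i \<in> {1..n}"
  shows "(\<lambda>t. full_coords n t i) \<in> borel_measurable (PiM {1..<n} (\<lambda>_. lborel))"
proof (cases "i = n")
  case False
  then have "i \<in> {1..<n}"
    using assms by auto
  then show ?thesis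
    by simp
qed simp

lemma measurable_coord_prod [measurable]:
  "coord_prod n \<in> borel_measurable (PiM {1..<n} (\<lambda>_. lborel))"
  unfolding coord_prod_def[abs_def] by measurable

text \<open>Extended by zero outside of the simplex.\<close>

definition dirichlet_weight :: "nat \<Rightarrow> (nat \<Rightarrow> real) \<Rightarrow> (nat \<Rightarrow> real) \<Rightarrow> real" where
  "dirichlet_weight n p t = (\<Prod>i\<in>{1..n}. pos_powr (p i) (full_coords n t i))"

lemma dirichlet_weight_nonneg [simp]: "0 \<le> dirichlet_weight n p t"
  by (simp add: dirichlet_weight_def prod_nonneg)

lemma measurable_dirichlet_weight [measurable]:
  "dirichlet_weight n p \<in> borel_measurable (PiM {1..<n} (\<lambda>_. lborel))"
  unfolding dirichlet_weight_def[abs_def] by measurable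

text \<open>Outside the simplex some full coordinate is negative and its \<open>pos_powr\<close>
  factor vanishes; inside, \<open>pos_powr\<close> and \<open>powr\<close> agree, even on the
  boundary. With \<open>g\<close> arbitrary, this covers both beta integrals.\<close>

lemma set_integral_simplex_E:
  assumes "n \<ge> 1"
  shows "(LINT t:simplex_E n|PiM {1..<n} (\<lambda>_. lborel).
            (\<Prod>i\<in>{1..n}. full_coords n t i powr (p i - 1)) * g t)
         = (LINT t|PiM {1..<n} (\<lambda>_. lborel). dirichlet_weight n p t * g t)"
  unfolding set_lebesgue_integral_def
proof (intro Bochner_Integration.integral_cong refl)
  fix t assume t: "t \<in> space (PiM {1..<n} (\<lambda>_. lborel :: real measure))"
  show "indicator (simplex_E n) t *\<^sub>R ((\<Prod>i\<in>{1..n}. full_coords n t i powr (p i - 1)) * g t)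
      = dirichlet_weight n p t * g t"
  proof (cases "t \<in> simplex_E n")
    case True
    then show ?thesis
      using simplex_E_iff[OF assms t] by (simp add: dirichlet_weight_def pos_powr_eq)
  next
    case False
    then obtain i where "i \<in> {1..n}" "full_coords n t i < 0"
      using simplex_E_iff[OF assms t] by (meson not_le)
    then have "dirichlet_weight n p t = 0"
      unfolding dirichlet_weight_def by (intro prod_zero) (auto intro!: bexI[of _ i])
    then show ?thesis
      using False by simp
  qed
qed

text \<open>Restricts pointwise estimates to interior points, so that zeros of
  \<open>coord_prod\<close> need no null-set argument.\<close>

lemma dirichlet_weight_pos_imp:
  assumes "dirichlet_weight n p t \<noteq> 0" "i \<in> {1..n}"
  shows "0 < full_coords n t i"
  using assms by (auto simp: dirichlet_weight_def pos_powr_def split: if_splits)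

text \<open>The Dirichlet integral with total \<open>1\<close> and last parameter
  \<open>p n\<close>, where the remaining power is \<open>1\<close>.\<close>

lemma dirichlet_weight_nn_integral:
  assumes "n \<ge> 1" "\<And>i. i \<in> {1..n} \<Longrightarrow> 0 < p i"
  obtains C where "0 < C"
    "(\<integral>\<^sup>+t. ennreal (dirichlet_weight n p t) \<partial>PiM {1..<n} (\<lambda>_. lborel)) = ennreal C"
proof -
  obtain C where C: "C > 0" and CI: "(\<integral>\<^sup>+t. ennreal ((\<Prod>i\<in>{1..<n}. pos_powr (p i) (t i))
      * pos_powr (p n) (1 - (\<Sum>i\<in>{1..<n}. t i))) \<partial>PiM {1..<n} (\<lambda>_. lborel))
      = ennreal (C * pos_powr (p n + (\<Sum>i\<in>{1..<n}. p i)) 1)"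
    using nn_integral_dirichlet[of "{1..<n}" p "p n"] assms by auto
  have "dirichlet_weight n p t = (\<Prod>i\<in>{1..<n}. pos_powr (p i) (t i))
      * pos_powr (p n) (1 - (\<Sum>i\<in>{1..<n}. t i))" for t
    using assms(1) by (simp add: dirichlet_weight_def atLeastAtMost_eq_insert mult.commute)
  with CI C show ?thesis
    by (intro that[of C]) (simp_all add: pos_powr_def)
qed

section \<open>Comparison of the two integrands and of their integrals\<close>

theorem theorem2p5:
  fixes n :: nat and k a b \<eta> \<zeta> :: real and \<phi> :: "nat \<Rightarrow> real"
  assumes "n \<ge> 2"
    and "k > 0" and "a > 0" and "b - a > 0" and "\<eta> > 0" and "\<zeta> \<ge> 0"
    and "\<And>i. i \<in> {1..n} \<Longrightarrow> \<phi> i > 0"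
  shows "ext_beta_k n k \<zeta> a b \<phi> \<eta> / beta_k n k \<phi> \<eta>
           \<ge> hyp1F1_k k a b (- (\<zeta> powr k / (\<eta> powr k * real n ^ n)))"
proof -
  let ?M = "PiM {1..<n} (\<lambda>_. lborel :: real measure)"
  define D where "D = dirichlet_weight n (\<lambda>i. \<phi> i / k)"
  \<comment> \<open>The argument of the k-function in the extended integrand is
    \<open>- A t - B t\<close>, and \<open>exp (- A t)\<close> is the kernel of the classical
    one.\<close>
  define A where "A t = \<eta> powr k / (k * coord_prod n t)" for t
  define B where "B t = \<zeta> powr k * (coord_prod n t / \<eta> powr k)" for t
  define H where "H = hyp1F1_k k a b (- (\<zeta> powr k / (\<eta> powr k * real n ^ n)))"
  note F = assms(2-4)
  have n1: "n \<ge> 1"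
    using assms(1) by simp
  have meas [measurable]: "D \<in> borel_measurable ?M" "A \<in> borel_measurable ?M"
      "B \<in> borel_measurable ?M"
    unfolding D_def A_def[abs_def] B_def[abs_def] by measurable
  have D_nonneg: "0 \<le> D t" for t
    by (simp add: D_def)
  \<comment> \<open>Off the support of \<open>D\<close> the coordinate product may be zero or
    negative, so these bounds are claimed only where \<open>D t\<close> is nonzero.\<close>
  have AB: "0 \<le> A t" "0 \<le> B t" "B t \<le> \<zeta> powr k / (\<eta> powr k * real n ^ n)"
    if "D t \<noteq> 0" for t
  proof -
    have pos: "0 < full_coords n t i" if "i \<in> {1..n}" for i
      using \<open>D t \<noteq> 0\<close> that unfolding D_def by (rule dirichlet_weight_pos_imp)
    then have P: "0 < coord_prod n t"
      unfolding coord_prod_def by (intro prod_pos) auto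
    show "0 \<le> A t" "0 \<le> B t"
      using P assms by (auto simp: A_def B_def)
    have "coord_prod n t \<le> 1 / real n ^ n"
      using coord_prod_le n1 pos by (simp add: less_imp_le)
    then have "\<zeta> powr k * (coord_prod n t / \<eta> powr k)
        \<le> \<zeta> powr k * ((1 / real n ^ n) / \<eta> powr k)"
      by (intro mult_left_mono divide_right_mono) auto
    then show "B t \<le> \<zeta> powr k / (\<eta> powr k * real n ^ n)"
      by (simp add: B_def mult.commute)
  qed
  obtain C where C: "0 < C" "(\<integral>\<^sup>+t. ennreal (D t) \<partial>?M) = ennreal C"
    using dirichlet_weight_nn_integral[of n "\<lambda>i. \<phi> i / k"] n1 assms unfolding D_def by auto
  have D_int: "integrable ?M D"
    using C D_nonneg by (intro integrableI_nonneg) auto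
  have E_int: "integrable ?M (\<lambda>t. D t * exp (- A t))"
  proof (rule Bochner_Integration.integrable_bound[OF D_int])
    have "norm (D t * exp (- A t)) \<le> norm (D t)" for t
      using AB(1)[of t] D_nonneg[of t] by (cases "D t = 0") (auto simp: mult_left_le)
    then show "AE t in ?M. norm (D t * exp (- A t)) \<le> norm (D t)"
      by simp
  qed measurable
  have G_int: "integrable ?M (\<lambda>t. D t * hyp1F1_k k a b (- A t - B t))"
  proof (rule Bochner_Integration.integrable_bound[OF D_int])
    \<comment> \<open>Since \<open>- A t - B t \<le> 0\<close> on the support, monotonicity and the
      value \<open>1\<close> at \<open>0\<close> place the k-function between \<open>0\<close> and
      \<open>1\<close>.\<close>
    have "norm (D t * hyp1F1_k k a b (- A t - B t)) \<le> norm (D t)" for t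
      using AB[of t] D_nonneg[of t] hyp1F1_k_nonneg[OF F] hyp1F1_k_mono[OF F, of "- A t - B t" 0]
      by (cases "D t = 0") (auto simp: abs_mult mult_left_le)
    then show "AE t in ?M. norm (D t * hyp1F1_k k a b (- A t - B t)) \<le> norm (D t)"
      by simp
  qed measurable
  have beta: "beta_k n k \<phi> \<eta> = 1 / k ^ (n - 1) * (LINT t|?M. D t * exp (- A t))"
    unfolding beta_k_def set_integral_simplex_E[OF n1] by (simp add: D_def A_def)
  have ext: "ext_beta_k n k \<zeta> a b \<phi> \<eta>
      = 1 / k ^ (n - 1) * (LINT t|?M. D t * hyp1F1_k k a b (- A t - B t))"
    unfolding ext_beta_k_def set_integral_simplex_E[OF n1] by (simp add: D_def A_def B_def)
  have "H * (LINT t|?M. D t * exp (- A t)) = (LINT t|?M. H * (D t * exp (- A t)))"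
    by simp
  also have "\<dots> \<le> (LINT t|?M. D t * hyp1F1_k k a b (- A t - B t))"
  proof (intro integral_mono integrable_mult_right E_int G_int)
    fix t
    show "H * (D t * exp (- A t)) \<le> D t * hyp1F1_k k a b (- A t - B t)"
    proof (cases "D t = 0")
      case False
      \<comment> \<open>The AM-GM bound on \<open>B t\<close> first replaces \<open>H\<close> by the
        value at \<open>- B t\<close>; then \<open>exp (- A t)\<close> is absorbed into the
        argument.\<close>
      have "exp (- A t) * H \<le> exp (- A t) * hyp1F1_k k a b (- B t)"
        unfolding H_def using AB[OF False] by (intro mult_left_mono hyp1F1_k_mono F) auto
      also have "\<dots> \<le> hyp1F1_k k a b (- B t - A t)"
        using AB[OF False] by (intro hyp1F1_k_ge_exp_mult F)
      finally have "D t * (exp (- A t) * H) \<le> D t * hyp1F1_k k a b (- B t - A t)"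
        using D_nonneg by (intro mult_left_mono) auto
      moreover have "- B t - A t = - A t - B t"
        by simp
      ultimately show ?thesis
        by (simp add: mult_ac)
    qed simp
  qed
  finally have key: "H * (LINT t|?M. D t * exp (- A t))
      \<le> (LINT t|?M. D t * hyp1F1_k k a b (- A t - B t))" .
  \<comment> \<open>The exponential never vanishes, so a zero integral would force
    \<open>D = 0\<close> almost everywhere, against its positive total mass
    \<open>C\<close>.\<close>
  have E_pos: "0 < (LINT t|?M. D t * exp (- A t))"
  proof (rule ccontr)
    assume "\<not> 0 < (LINT t|?M. D t * exp (- A t))"
    moreover have "0 \<le> (LINT t|?M. D t * exp (- A t))"
      using D_nonneg by (intro Bochner_Integration.integral_nonneg) auto
    ultimately have "AE t in ?M. D t * exp (- A t) = 0"
      using integral_nonneg_eq_0_iff_AE[OF E_int] D_nonneg by auto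
    then have "(\<integral>\<^sup>+t. ennreal (D t) \<partial>?M) = 0"
      by (subst nn_integral_0_iff_AE) auto
    with C show False
      by simp
  qed
  \<comment> \<open>The common factor \<open>1 / k ^ (n - 1)\<close> cancels in the
    quotient.\<close>
  show ?thesis
    unfolding ext beta H_def[symmetric] using key E_pos assms(2) by (simp add: pos_le_divide_eq)
qed

end
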